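(* Let $\Psi=\Psi^{(N)}\in\mathbb{R}^{N\times N}$ be a sequence of symmetric orthogonal matrices with $\max_{i,j}|\psi_{ij}|=O(N^{-1/2+\epsilon})$ for every fixed $\epsilon>0$. Let $S=\mathrm{diag}(s_1,\dots,s_N)$ with $s_1,\dots,s_N$ i.i.d. uniform on $\{\pm1\}$. Then $M=S\Psi S$ is a semi-random matrix ensemble with constant $\sigma_\psi^2=1$.
   Context: **Semi-random matrix ensemble.** A sequence of random matrices $M^{(N)}\in\mathbb{R}^{N\times N}$ of the form $M^{(N)}=S\Psi S$ where $S=\mathrm{diag}(s_1,\dots,s_N)$ with $s_i$ i.i.d. uniform on $\{\pm1\}$, and $\Psi=\Psi^{(N)}$ is a sequence of deterministic matrices such that: (a) $\max_{i,j}|\psi_{ij}|=O(N^{-1/2+\epsilon})$ for every fixed $\epsilon>0$; (b) $\|\Psi\|_{\mathrm{op}}=O(1)$; (c) $\max_{i\ne j}|(\Psi\Psi^{\mathsf T})_{ij}|=O(N^{-1/2+\epsilon})$ for every fixed $\epsilon>0$; (d) there is a constant $\sigma_\psi^2\in(0,\infty)$ independent of $N$ with $\max_{i}|(\Psi\Psi^{\mathsf T})_{ii}-\sigma_\psi^2|\to0$. *)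

theory Defs
  imports
    "HOL-Probability.Probability"
    "HOL-Library.Landau_Symbols"
    "Jordan_Normal_Form.Matrix"
begin

(* Matrices whose size depends on N are taken from Jordan_Normal_Form; indices run over {..<N}.
   That session's orthogonal_mat only asks for pairwise orthogonal nonzero columns. *)
definition orthonormal_mat :: "nat \<Rightarrow> real mat \<Rightarrow> bool" where
  "orthonormal_mat n A \<longleftrightarrow>
     A \<in> carrier_mat n n \<and> A * transpose_mat A = 1\<^sub>m n \<and> transpose_mat A * A = 1\<^sub>m n"

definition l2_norm :: "real vec \<Rightarrow> real" where
  "l2_norm v = sqrt (v \<bullet> v)"

(* The set is nonempty (v = 0) and bounded above, so this is a genuine supremum. *)
definition mat_op_norm :: "real mat \<Rightarrow> real" where
  "mat_op_norm A =
     (SUP v \<in> {v \<in> carrier_vec (dim_col A). l2_norm v \<le> 1}. l2_norm (A *\<^sub>v v))"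

definition iid_signs :: "'w measure \<Rightarrow> nat \<Rightarrow> (nat \<Rightarrow> 'w \<Rightarrow> real) \<Rightarrow> bool" where
  "iid_signs P n s \<longleftrightarrow>
     prob_space P \<and>
     prob_space.indep_vars P (\<lambda>_. count_space {-1, 1}) s {..<n} \<and>
     (\<forall>i<n. distr P (count_space {-1, 1}) (s i) = uniform_count_measure {-1, 1})"

definition sign_conjugate :: "nat \<Rightarrow> (nat \<Rightarrow> 'w \<Rightarrow> real) \<Rightarrow> real mat \<Rightarrow> 'w \<Rightarrow> real mat" where
  "sign_conjugate n s A \<omega> = mat_diag n (\<lambda>i. s i \<omega>) * A * mat_diag n (\<lambda>i. s i \<omega>)"

definition delocalized :: "(nat \<Rightarrow> real mat) \<Rightarrow> bool" where
  "delocalized \<Psi> \<longleftrightarrow>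
     (\<forall>\<epsilon>>0. (\<lambda>N. MAX (i, j) \<in> {..<N} \<times> {..<N}. \<bar>\<Psi> N $$ (i, j)\<bar>)
              \<in> O(\<lambda>N. real N powr (-1/2 + \<epsilon>)))"

(* The values of Max on the empty index sets (N = 0, and N = 1 off the diagonal)
   are irrelevant, since only the behaviour as N tends to infinity matters. *)
definition semi_random_profile :: "(nat \<Rightarrow> real mat) \<Rightarrow> real \<Rightarrow> bool" where
  "semi_random_profile \<Psi> \<sigma>2 \<longleftrightarrow>
     (\<forall>N. \<Psi> N \<in> carrier_mat N N) \<and>
     delocalized \<Psi> \<and>
     (\<lambda>N. mat_op_norm (\<Psi> N)) \<in> O(\<lambda>_. 1) \<and>
     (\<forall>\<epsilon>>0. (\<lambda>N. MAX (i, j) \<in> {(i, j). i < N \<and> j < N \<and> i \<noteq> j}.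
                     \<bar>(\<Psi> N * transpose_mat (\<Psi> N)) $$ (i, j)\<bar>)
              \<in> O(\<lambda>N. real N powr (-1/2 + \<epsilon>))) \<and>
     0 < \<sigma>2 \<and>
     (\<lambda>N. MAX i \<in> {..<N}. \<bar>(\<Psi> N * transpose_mat (\<Psi> N)) $$ (i, i) - \<sigma>2\<bar>) \<longlonglongrightarrow> 0"

(* \<sigma>2 stands for the squared constant. The sample space may depend on N; no joint law
   across different N is prescribed. *)
definition semi_random_ensemble ::
    "(nat \<Rightarrow> 'w measure) \<Rightarrow> (nat \<Rightarrow> 'w \<Rightarrow> real mat) \<Rightarrow> real \<Rightarrow> bool" where
  "semi_random_ensemble P M \<sigma>2 \<longleftrightarrow>
     (\<exists>s \<Psi>. (\<forall>N. iid_signs (P N) N (s N)) \<and>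
            semi_random_profile \<Psi> \<sigma>2 \<and>
            (\<forall>N. \<forall>\<omega>\<in>space (P N). M N \<omega> = sign_conjugate N (s N) (\<Psi> N) \<omega>))"

end

theory Submission
  imports Defs
begin

text \<open>The randomness sits entirely in the signs, so the work is to check the deterministic
  conditions on \<Psi>. Orthogonality makes \<Psi> an isometry, which bounds the operator norm by 1
  (\<open>orthonormal_mat_op_norm_le\<close>). It also makes \<Psi> times its transpose the
  identity, so the off-diagonal entries vanish and the diagonal ones equal 1, the claimed constant.
  Delocalization of the entries is assumed. \<open>orthonormal_semi_random_profile\<close> collects
  these facts.\<close>

lemma orthonormal_mat_l2_norm:
  assumes A: "orthonormal_mat n A" and v: "v \<in> carrier_vec n"
  shows "l2_norm (A *\<^sub>v v) = l2_norm v"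
proof -
  have Ac: "A \<in> carrier_mat n n" and AtA: "transpose_mat A * A = 1\<^sub>m n"
    using A by (auto simp: orthonormal_mat_def)
  have Av: "A *\<^sub>v v \<in> carrier_vec n"
    using Ac v by simp
  have "(A *\<^sub>v v) \<bullet> (A *\<^sub>v v) = (transpose_mat A *\<^sub>v (A *\<^sub>v v)) \<bullet> v"
    by (rule transpose_vec_mult_scalar[OF Ac v Av, symmetric])
  also have "transpose_mat A *\<^sub>v (A *\<^sub>v v) = (transpose_mat A * A) *\<^sub>v v"
    by (rule assoc_mult_mat_vec[symmetric, of _ n n _ n]) (use Ac v in auto)
  also have "\<dots> = v"
    using AtA v by simp
  finally show ?thesis
    by (simp add: l2_norm_def)
qed

text \<open>By the isometry property the supremum is that of \<open>l2_norm\<close> over the unit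
  ball, hence between 0 (the value at the zero vector) and 1. An inequality is stated because the
  norm is 0 when \<open>n = 0\<close>; the absolute value suits the big-O bound.\<close>

lemma orthonormal_mat_op_norm_le:
  assumes "orthonormal_mat n A"
  shows "\<bar>mat_op_norm A\<bar> \<le> 1"
proof -
  let ?B = "{v \<in> carrier_vec n. l2_norm v \<le> 1}"
  have dim: "dim_col A = n"
    using assms by (auto simp: orthonormal_mat_def)
  have norm: "mat_op_norm A = (SUP v \<in> ?B. l2_norm v)"
    unfolding mat_op_norm_def dim
    by (rule SUP_cong) (use orthonormal_mat_l2_norm[OF assms] in auto)
  have zero: "0\<^sub>v n \<in> ?B" "l2_norm (0\<^sub>v n) = 0"
    by (auto simp: l2_norm_def)
  have "(SUP v \<in> ?B. l2_norm v) \<le> 1"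
    by (rule cSUP_least) (use zero(1) in blast, simp)
  moreover have "bdd_above (l2_norm ` ?B)"
    by (auto simp: bdd_above_def)
  then have "l2_norm (0\<^sub>v n) \<le> (SUP v \<in> ?B. l2_norm v)"
    using zero(1) by (intro cSUP_upper)
  ultimately show ?thesis
    using norm zero(2) by simp
qed

lemma Max_image_const:
  assumes "finite A" "A \<noteq> {}" "\<And>x. x \<in> A \<Longrightarrow> f x = c"
  shows "Max (f ` A) = c"
proof -
  have "f ` A = {c}"
    using assms by auto
  then show ?thesis
    by simp
qed

lemma orthonormal_semi_random_profile:
  assumes orth: "\<And>N. orthonormal_mat N (\<Psi> N)" and entries: "delocalized \<Psi>"
  shows "semi_random_profile \<Psi> 1"
proof -
  have AAt: "\<Psi> N * transpose_mat (\<Psi> N) = 1\<^sub>m N" for N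
    using orth by (simp add: orthonormal_mat_def)
  have carrier: "\<Psi> N \<in> carrier_mat N N" for N
    using orth by (simp add: orthonormal_mat_def)
  have op_norm: "(\<lambda>N. mat_op_norm (\<Psi> N)) \<in> O(\<lambda>_. 1)"
    by (rule bigoI[of _ 1]) (use orthonormal_mat_op_norm_le[OF orth] in simp)
  \<comment> \<open>Only eventually: for \<open>N < 2\<close> there are no off-diagonal pairs, and
    the value of \<open>Max\<close> on the empty set is unspecified.\<close>
  have off_diag: "\<forall>\<^sub>F N in sequentially.
      (MAX (i, j) \<in> {(i, j). i < N \<and> j < N \<and> i \<noteq> j}.
        \<bar>(\<Psi> N * transpose_mat (\<Psi> N)) $$ (i, j)\<bar>) = 0"
    using eventually_ge_at_top[of 2]
  proof eventually_elim
    case (elim N)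
    have "finite {(i, j). i < N \<and> j < N \<and> i \<noteq> j}"
      by (rule finite_subset[of _ "{..<N} \<times> {..<N}"]) auto
    moreover have "(0, 1) \<in> {(i, j). i < N \<and> j < N \<and> i \<noteq> j}"
      using elim by simp
    then have "{(i, j). i < N \<and> j < N \<and> i \<noteq> j} \<noteq> {}"
      by blast
    ultimately show ?case
      by (rule Max_image_const) (auto simp: AAt)
  qed
  \<comment> \<open>Here \<open>N > 0\<close> is enough to make the index set nonempty.\<close>
  have diag: "\<forall>\<^sub>F N in sequentially.
      (MAX i \<in> {..<N}. \<bar>(\<Psi> N * transpose_mat (\<Psi> N)) $$ (i, i) - 1\<bar>) = 0"
    using eventually_gt_at_top[of 0]
    by eventually_elim (rule Max_image_const, auto simp: AAt)
  show ?thesis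
    \<comment> \<open>Big-O classes and limits see only eventual values, so both maxima may be
      replaced by 0.\<close>
    unfolding semi_random_profile_def
    using carrier entries op_norm landau_o.big.in_cong[OF off_diag] tendsto_eventually[OF diag]
    by simp
qed

theorem lemma1:
  fixes P :: "nat \<Rightarrow> 'w measure"
    and s :: "nat \<Rightarrow> nat \<Rightarrow> 'w \<Rightarrow> real"
    and \<Psi> :: "nat \<Rightarrow> real mat"
  assumes symmetric: "\<And>N. transpose_mat (\<Psi> N) = \<Psi> N"
    and orthogonal: "\<And>N. orthonormal_mat N (\<Psi> N)"
    and entries: "delocalized \<Psi>"
    and signs: "\<And>N. iid_signs (P N) N (s N)"
  shows "semi_random_ensemble P (\<lambda>N. sign_conjugate N (s N) (\<Psi> N)) 1"
  \<comment> \<open>The existential witnesses are the given \<open>s\<close> and \<Psi>, for which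
    the required form of the matrix holds by reflexivity.\<close>
  unfolding semi_random_ensemble_def
  using signs orthonormal_semi_random_profile[OF orthogonal entries] by blast

end
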